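(* Let $n\in\mathbb{N}$, $a\in\mathbb{R}$, let $L_n^{\beta}(x)$ be the associated Laguerre polynomials with parameter $\beta$, and let $f$ be an arbitrary differentiable function (for which the fractional derivatives below are defined). Then \[ (\partial_x)^{a}\,[L_n^{\beta}(x) f(x)] = \sum_{m=0}^{n}\sum_{k=1}^{m}\binom{n}{m}\binom{m-1}{k-1}\frac{m!}{k!}\,L_{n-m}^{\beta}(x)\,(-1)^{k}(a)_{k}\,(\partial_x)^{a-k}[f(x)]. \]
   Context: The associated Laguerre polynomials $L_n^\beta(x)$ are (with this normalization) the polynomials with generating function \[ \frac{1}{(1-t)^{\beta+1}}\,e^{x\frac{t}{t-1}}=\sum_{m=0}^{\infty}\frac{L_m^{\beta}(x)\,t^m}{m!}; \] they are the Sheffer sequence for the pair $\left((1-t)^{-\beta-1},\frac{t}{t-1}\right)$. $(a)_k = a(a-1)\cdots(a-k+1)$ is the falling factorial, and $\binom{a}{m}=(a)_m/m!$. For $a\in\mathbb{R}$, $(\partial_x)^a$ denotes fractional differentiation of order $a$ with respect to $x$: a family of linear operators which agree with the ordinary derivative of order $a$ when $a$ is a nonnegative integer and which obey the extension of the general Leibniz rule to real order: for a polynomial $p$ and a function $f$ for which the terms exist, \[ (\partial_x)^a[p(x)f(x)] = \sum_{m=0}^{\infty}\binom{a}{m}\,(\partial_x)^{a-m}[f(x)]\;p^{(m)}(x). \]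
   Formalization: The printed formula omits the m = k = 0 term and fails for n = 0, where its right side is an empty sum; the formal statement adds the missing summand L_n^β(x) (∂_x)^a[f(x)] to the printed double sum. *)

theory Defs
  imports "HOL-Analysis.Analysis" "HOL-Computational_Algebra.Computational_Algebra"
begin

definition falling_fact :: "real \<Rightarrow> nat \<Rightarrow> real" where
  "falling_fact a k = (\<Prod>i<k. a - real i)"

text \<open>
  The generating function is read as a formal power series in \<open>t\<close>. Since
  \<^term>\<open>fps_binomial c\<close> is \<open>(1 + t)\<^sup>c\<close> and \<^term>\<open>fps_exp x\<close> is \<open>e\<^sup>x\<^sup>t\<close>, the series below
  is \<open>(1 - t)\<close> to the power \<open>- (\<beta> + 1)\<close>, times \<open>exp (x * t / (t - 1))\<close>.
\<close>

definition laguerre_gf :: "real \<Rightarrow> real \<Rightarrow> real fps" where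
  "laguerre_gf \<beta> x =
     (fps_binomial (- (\<beta> + 1)) oo (- fps_X)) * (fps_exp x oo (fps_X / (fps_X - 1)))"

definition laguerre :: "real \<Rightarrow> nat \<Rightarrow> real \<Rightarrow> real" where
  "laguerre \<beta> n x = fact n * fps_nth (laguerre_gf \<beta> x) n"

definition times_differentiable_on :: "nat \<Rightarrow> (real \<Rightarrow> real) \<Rightarrow> real set \<Rightarrow> bool" where
  "times_differentiable_on n f S \<longleftrightarrow>
     (\<forall>k<n. \<forall>x\<in>S. (deriv ^^ k) f field_differentiable at x)"

text \<open>
  A family of fractional derivatives on an open set \<open>S\<close>: \<open>dom a\<close> is the set of functions whose
  derivative of order \<open>a\<close> is defined on \<open>S\<close>, and \<open>D a\<close> is the operator. Values outside \<open>S\<close> carry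
  no meaning. In the Leibniz rule only the terms with \<open>m \<le> degree p\<close> are required to exist;
  the others have the factor \<open>p\<^sup>(\<^sup>m\<^sup>) = 0\<close>, so the series is a finite sum.
\<close>

locale fractional_derivative =
  fixes S :: "real set"
    and dom :: "real \<Rightarrow> (real \<Rightarrow> real) set"
    and D :: "real \<Rightarrow> (real \<Rightarrow> real) \<Rightarrow> real \<Rightarrow> real"
  assumes open_S: "open S"
    and dom_linear:
      "\<And>a f g c d. f \<in> dom a \<Longrightarrow> g \<in> dom a \<Longrightarrow> (\<lambda>x. c * f x + d * g x) \<in> dom a"
    and D_linear:
      "\<And>a f g c d x. f \<in> dom a \<Longrightarrow> g \<in> dom a \<Longrightarrow> x \<in> S \<Longrightarrow>
         D a (\<lambda>x. c * f x + d * g x) x = c * D a f x + d * D a g x"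
    and dom_nat: "\<And>n f. times_differentiable_on n f S \<Longrightarrow> f \<in> dom (real n)"
    and D_nat:
      "\<And>n f x. times_differentiable_on n f S \<Longrightarrow> x \<in> S \<Longrightarrow> D (real n) f x = (deriv ^^ n) f x"
    and leibniz:
      "\<And>a p f x. (\<lambda>x. poly p x * f x) \<in> dom a \<Longrightarrow>
         (\<And>m. m \<le> degree p \<Longrightarrow> f \<in> dom (a - real m)) \<Longrightarrow> x \<in> S \<Longrightarrow>
         D a (\<lambda>x. poly p x * f x) x =
           (\<Sum>m. (a gchoose m) * D (a - real m) f x * poly ((pderiv ^^ m) p) x)"

end

theory Submission
  imports Defs
begin

text \<open>
  Write \<open>T = t / (t - 1)\<close>. Differentiating the generating function \<open>j\<close> times in \<open>x\<close> multiplies it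
  by \<open>T\<^sup>j\<close>, whose coefficient at \<open>t\<^sup>m\<close> is \<open>(-1)\<^sup>j\<close> times \<open>m - 1\<close> choose \<open>j - 1\<close>. This
  expresses the derivatives of a Laguerre polynomial by Laguerre polynomials of lower degree, and
  the Leibniz rule does the rest.
\<close>

lemma fps_X_div_X_minus_1:
  "fps_X / (fps_X - 1) = - (fps_X * inverse (1 - fps_X :: 'a::field fps))"
proof -
  have "inverse (fps_X - 1 :: 'a fps) = - inverse (1 - fps_X)"
    using fps_inverse_minus[of "1 - fps_X :: 'a fps"] by simp
  thus ?thesis
    by (subst fps_divide_unit) auto
qed

text \<open>T^j = (-1)^j t^j (1 - t)^(-j), and the negative binomial series gives
  \<open>(j + k - 1) choose k\<close> at k = m - j. For j = 0 the truncated \<open>j - 1\<close>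
  would give the constant 1 for every m, hence \<open>0 < j\<close>.\<close>

lemma fps_X_div_X_minus_1_power_nth:
  assumes "0 < j"
  shows "(fps_X / (fps_X - 1 :: 'a::field_char_0 fps)) ^ j $ m =
    (if m < j then 0 else (-1) ^ j * of_nat ((m - 1) choose (j - 1)))"
proof -
  have inv: "inverse (1 - fps_X :: 'a fps) ^ j = Abs_fps (\<lambda>k. of_nat ((j + k - 1) choose k))"
    using one_minus_const_fps_X_neg_power'[OF assms, of "1::'a"]
    by (simp add: fps_inverse_power)
  have "(fps_X / (fps_X - 1 :: 'a fps)) ^ j =
      (-1) ^ j * (fps_X ^ j * inverse (1 - fps_X) ^ j)"
    unfolding fps_X_div_X_minus_1 by (subst power_minus) (simp add: power_mult_distrib)
  also have "\<dots> = fps_const ((-1) ^ j) * (fps_X ^ j * inverse (1 - fps_X) ^ j)"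
    by (simp add: fps_const_power [symmetric] fps_const_neg [symmetric])
  finally have "(fps_X / (fps_X - 1 :: 'a fps)) ^ j $ m =
      (if m < j then 0 else (-1) ^ j * of_nat ((m - 1) choose (m - j)))"
    by (simp add: fps_X_power_mult_nth inv)
  moreover have "(m - 1) choose (m - j) = (m - 1) choose (j - 1)" if "j \<le> m"
    using that assms binomial_symmetric[of "j - 1" "m - 1"] by simp
  ultimately show ?thesis by simp
qed

lemma fps_mult_compose_nth:
  fixes A F T :: "'a::comm_ring_1 fps"
  assumes "T $ 0 = 0"
  shows "(A * (F oo T)) $ n = (\<Sum>i\<le>n. F $ i * (A * T ^ i) $ n)"
proof -
  \<comment> \<open>As T^i has no terms below t^i, the range i \<le> n - l extends to i \<le> n; it
    no longer depends on l, so the two sums can be exchanged.\<close>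
  have ext: "(F oo T) $ (n - l) = (\<Sum>i\<le>n. F $ i * (T ^ i) $ (n - l))" for l
    unfolding fps_compose_nth atLeast0AtMost
    by (rule sum.mono_neutral_left) (auto simp: startsby_zero_power_prefix[OF assms])
  show ?thesis
    unfolding fps_mult_nth atLeast0AtMost ext sum_distrib_left
    by (subst sum.swap) (simp add: mult_ac)
qed

text \<open>Expanding e^(xT) as the sum of x^k T^k / k! and collecting powers of x in n! times the
  t^n coefficient gives these coefficients. A genuine polynomial is what \<open>leibniz\<close> and
  \<open>pderiv\<close> act on.\<close>

definition laguerre_poly :: "real \<Rightarrow> nat \<Rightarrow> real poly" where
  "laguerre_poly \<beta> n = (\<Sum>k\<le>n. monom
     (fact n / fact k * ((fps_binomial (- (\<beta> + 1)) oo (- fps_X)) * (fps_X / (fps_X - 1)) ^ k) $ n) k)"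

lemma degree_laguerre_poly: "degree (laguerre_poly \<beta> n) \<le> n"
  unfolding laguerre_poly_def
  by (intro degree_sum_le) (auto intro: order.trans[OF degree_monom_le])

text \<open>For k > n both sides vanish, because T^k starts at t^k. The formula thus holds for every
  k.\<close>

lemma coeff_laguerre_poly:
  "coeff (laguerre_poly \<beta> n) k =
     fact n / fact k * ((fps_binomial (- (\<beta> + 1)) oo (- fps_X)) * (fps_X / (fps_X - 1)) ^ k) $ n"
proof (cases "k \<le> n")
  case True
  thus ?thesis by (simp add: laguerre_poly_def coeff_sum)
next
  case False
  have "(fps_X / (fps_X - 1 :: real fps)) ^ k $ (n - l) = 0" for l
    using False by (intro startsby_zero_power_prefix[rule_format]) (auto simp: fps_X_div_X_minus_1)
  with False show ?thesis by (simp add: laguerre_poly_def coeff_sum fps_mult_nth)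
qed

text \<open>This is d/dx e^(xT) = T e^(xT), checked coefficient by coefficient in x. The case j = 0
  identifies \<open>laguerre_poly\<close> with \<open>laguerre\<close>.\<close>

lemma poly_higher_pderiv_laguerre_poly:
  "poly ((pderiv ^^ j) (laguerre_poly \<beta> n)) x =
     fact n * (laguerre_gf \<beta> x * (fps_X / (fps_X - 1)) ^ j) $ n"
proof -
  define B where "B = fps_binomial (- (\<beta> + 1)) oo (- fps_X :: real fps)"
  define T where "T = (fps_X / (fps_X - 1) :: real fps)"
  have T0: "T $ 0 = 0" by (simp add: T_def fps_X_div_X_minus_1)
  have "degree ((pderiv ^^ j) (laguerre_poly \<beta> n)) \<le> n"
    using degree_laguerre_poly[of \<beta> n] by (simp add: degree_higher_pderiv)
  hence "poly ((pderiv ^^ j) (laguerre_poly \<beta> n)) x =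
      (\<Sum>i\<le>n. coeff ((pderiv ^^ j) (laguerre_poly \<beta> n)) i * x ^ i)"
    unfolding poly_altdef by (intro sum.mono_neutral_left) (auto simp: coeff_eq_0)
  also have "\<dots> = (\<Sum>i\<le>n. fact n * (fps_exp x $ i * (B * T ^ j * T ^ i) $ n))"
  proof (rule sum.cong[OF refl])
    fix i
    have "coeff ((pderiv ^^ j) (laguerre_poly \<beta> n)) i =
        pochhammer (of_nat (Suc i)) j * (fact n / fact (i + j) * (B * T ^ (i + j)) $ n)"
      by (simp add: coeff_higher_pderiv coeff_laguerre_poly B_def T_def)
    \<comment> \<open>The factor (i+1)...(i+j) from differentiating cancels (i+j)! down to i!,
      leaving x^i / i!, the coefficient of \<open>fps_exp x\<close>.\<close>
    also have "pochhammer (of_nat (Suc i)) j = (fact (i + j) / fact i :: real)"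
      using pochhammer_product'[of "1::real" i j]
      by (simp add: pochhammer_fact [symmetric] field_simps)
    finally show "coeff ((pderiv ^^ j) (laguerre_poly \<beta> n)) i * x ^ i =
        fact n * (fps_exp x $ i * (B * T ^ j * T ^ i) $ n)"
      by (simp add: power_add mult_ac)
  qed
  also have "\<dots> = fact n * (B * T ^ j * (fps_exp x oo T)) $ n"
    by (simp add: fps_mult_compose_nth[OF T0] sum_distrib_left)
  finally show ?thesis
    by (simp add: laguerre_gf_def B_def T_def mult_ac)
qed

lemma poly_laguerre_poly: "poly (laguerre_poly \<beta> n) x = laguerre \<beta> n x"
  using poly_higher_pderiv_laguerre_poly[of 0 \<beta> n x] by (simp add: laguerre_def)

text \<open>The t^n coefficient of the product is a Cauchy sum; n! / (n-m)! = (n choose m) m! turns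
  its terms into Laguerre values.\<close>

lemma higher_pderiv_laguerre:
  assumes "0 < j"
  shows "poly ((pderiv ^^ j) (laguerre_poly \<beta> n)) x =
    (\<Sum>m=j..n. real (n choose m) * real ((m - 1) choose (j - 1)) * fact m *
       laguerre \<beta> (n - m) x * (-1) ^ j)"
proof -
  have "poly ((pderiv ^^ j) (laguerre_poly \<beta> n)) x =
      (\<Sum>m=0..n. fact n * ((fps_X / (fps_X - 1)) ^ j $ m * laguerre_gf \<beta> x $ (n - m)))"
    by (simp add: poly_higher_pderiv_laguerre_poly mult.commute[of "laguerre_gf \<beta> x"]
        fps_mult_nth sum_distrib_left)
  also have "\<dots> = (\<Sum>m=j..n. fact n * ((fps_X / (fps_X - 1)) ^ j $ m * laguerre_gf \<beta> x $ (n - m)))"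
    by (rule sum.mono_neutral_right) (auto simp: fps_X_div_X_minus_1_power_nth[OF assms])
  also have "\<dots> = (\<Sum>m=j..n. real (n choose m) * real ((m - 1) choose (j - 1)) * fact m *
       laguerre \<beta> (n - m) x * (-1) ^ j)"
    by (rule sum.cong)
      (auto simp: fps_X_div_X_minus_1_power_nth[OF assms] laguerre_def binomial_fact)
  finally show ?thesis .
qed

lemma gchoose_eq_falling_fact: "a gchoose k = falling_fact a k / fact k"
  by (simp add: falling_fact_def gbinomial_prod_rev atLeast0LessThan)

theorem theorem4p12:
  fixes n :: nat and a \<beta> x :: real and S :: "real set"
    and dom :: "real \<Rightarrow> (real \<Rightarrow> real) set"
    and D :: "real \<Rightarrow> (real \<Rightarrow> real) \<Rightarrow> real \<Rightarrow> real"
    and f :: "real \<Rightarrow> real"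
  assumes "fractional_derivative S dom D"
    and "f differentiable_on S"
    and "(\<lambda>y. laguerre \<beta> n y * f y) \<in> dom a"
    and "\<And>k. k \<le> n \<Longrightarrow> f \<in> dom (a - real k)"
    and "x \<in> S"
  shows "D a (\<lambda>y. laguerre \<beta> n y * f y) x =
    laguerre \<beta> n x * D a f x +
    (\<Sum>m=0..n. \<Sum>k=1..m.
       real (n choose m) * real ((m - 1) choose (k - 1)) * (fact m / fact k) *
       laguerre \<beta> (n - m) x * (-1) ^ k * falling_fact a k * D (a - real k) f x)"
proof -
  let ?p = "laguerre_poly \<beta> n"
  let ?t = "\<lambda>k. (a gchoose k) * D (a - real k) f x * poly ((pderiv ^^ k) ?p) x"
  let ?s = "\<lambda>m k. real (n choose m) * real ((m - 1) choose (k - 1)) * (fact m / fact k) *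
       laguerre \<beta> (n - m) x * (-1) ^ k * falling_fact a k * D (a - real k) f x"
  interpret fractional_derivative S dom D by fact
  have "D a (\<lambda>y. poly ?p y * f y) x = (\<Sum>k. ?t k)"
    using assms(3-5) degree_laguerre_poly[of \<beta> n]
    by (intro leibniz) (auto simp: poly_laguerre_poly)
  \<comment> \<open>Cutting at n suffices: the degree is at most n, so all later derivatives of the
    polynomial are zero.\<close>
  also have "\<dots> = (\<Sum>k=0..n. ?t k)"
  proof (rule suminf_finite)
    fix k assume "k \<notin> {0..n}"
    hence "degree ?p < k"
      using degree_laguerre_poly[of \<beta> n] by simp
    hence "(pderiv ^^ k) ?p = 0"
      by (intro poly_eqI) (simp add: coeff_higher_pderiv coeff_eq_0)
    thus "?t k = 0" by simp
  qed simp
  \<comment> \<open>The term k = 0 is kept apart, since \<open>higher_pderiv_laguerre\<close>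
    requires a positive order; it is the summand outside the double sum.\<close>
  also have "\<dots> = ?t 0 + (\<Sum>k=1..n. ?t k)"
    by (simp add: sum.atLeast_Suc_atMost)
  also have "?t 0 = laguerre \<beta> n x * D a f x"
    by (simp add: poly_laguerre_poly)
  also have "(\<Sum>k=1..n. ?t k) = (\<Sum>k=1..n. \<Sum>m=k..n. ?s m k)"
    by (intro sum.cong refl)
      (simp add: higher_pderiv_laguerre gchoose_eq_falling_fact sum_distrib_left mult_ac)
  \<comment> \<open>Both sums run over the triangle 1 \<le> k \<le> m \<le> n; at m = 0 the inner
    sum is empty.\<close>
  also have "\<dots> = (\<Sum>m=0..n. \<Sum>k=1..m. ?s m k)"
    unfolding sum.Sigma[OF finite_atLeastAtMost ballI[OF finite_atLeastAtMost]]
    by (rule sum.reindex_bij_witness[of _ prod.swap prod.swap]) auto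
  finally show ?thesis
    by (simp add: poly_laguerre_poly)
qed

end
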